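(* Let $S$ be a finite non-empty set, let $P=(p_{i,j})_{i,j\in S}$ be an irreducible stochastic matrix on $S$, and let $\mathcal{S}=\{S_r: r\in I\}$ be a partition of $S$ into (non-empty) blocks with index set $I=\{1,2,\dots,\ell\}$. Assume that (1) for all $r,s\in I$, the sum $\sum_{j\in S_s}p_{i,j}$ takes the same value, denoted $\lambda_{r,s}$, for all $i\in S_r$; and (2) the matrix $\Lambda=(\lambda_{r,s})_{r,s\in I}$ is doubly stochastic. Let $\rho$ be a probability measure on the set of permutations of $I$ such that $\rho(\{\pi:\pi(r)=s\})=\lambda_{r,s}$ for all $r,s\in I$, and let $\mu$ be the $(P,\mathcal{S},\rho)$-product measure on the set of functions $S\to S$. Then $k(\mu)=\ell$ if and only if $$\mathbb{P}(i\sim j)>0\quad\text{for all } i,j\in S_1 .$$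
   Context: Let $\mathcal{F}_S$ be the set of all functions from $S$ to $S$. Product measure: let $\Pi$ be a random permutation of $I$ with law $\rho$. Conditional on $\Pi$, let $(Z_i:i\in S)$ be independent $S$-valued random variables such that, for $i\in S_r$ and $j\in S_s$, $\mathbb{P}(Z_i=j\mid\Pi)=p_{i,j}/\lambda_{r,s}$ if $\Pi(r)=s$, and $\mathbb{P}(Z_i=j\mid\Pi)=0$ otherwise. (Almost surely $\lambda_{r,\Pi(r)}>0$ for all $r$.) The $(P,\mathcal{S},\rho)$-product measure $\mu$ is the law of the random function $i\mapsto Z_i$; that is, $\mu(\{f\})=\mathbb{E}\big[\prod_{i\in S}\mathbb{P}(Z_i=f(i)\mid\Pi)\big]$ for $f\in\mathcal{F}_S$. Coalescence: for a probability measure $\mu$ on $\mathcal{F}_S$, let $F_1,F_2,\dots$ be independent random functions with law $\mu$, and let $X^i_0=i$ and $X^i_t=F_t\circ F_{t-1}\circ\cdots\circ F_1(i)$ for $i\in S$, $t\ge1$. Write $i\sim j$ if $X^i_t=X^j_t$ for some $t\ge 0$. This is a random equivalence relation on $S$; its equivalence classes are called coalescence classes. The number of coalescence classes is almost surely equal to a constant, which is denoted $k(\mu)$. In the claim, $\mathbb{P}(i\sim j)$ is computed with the $F_t$ having law $\mu$. *)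

theory Defs
  imports "HOL-Probability.Probability" "HOL-Combinatorics.Permutations"
begin

text \<open>
  The state space \<open>S\<close> is a finite type (finite types are non-empty).  Matrices are curried
  functions restricted to an explicit index set, because the index set \<open>{1..l}\<close> of \<open>\<Lambda>\<close> depends
  on a variable.
\<close>

definition stochastic_on :: "'i set \<Rightarrow> ('i \<Rightarrow> 'i \<Rightarrow> real) \<Rightarrow> bool" where
  "stochastic_on A M \<longleftrightarrow> (\<forall>i\<in>A. \<forall>j\<in>A. M i j \<ge> 0) \<and> (\<forall>i\<in>A. (\<Sum>j\<in>A. M i j) = 1)"

definition doubly_stochastic_on :: "'i set \<Rightarrow> ('i \<Rightarrow> 'i \<Rightarrow> real) \<Rightarrow> bool" where
  "doubly_stochastic_on A M \<longleftrightarrow> stochastic_on A M \<and> (\<forall>j\<in>A. (\<Sum>i\<in>A. M i j) = 1)"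

primrec step_prob :: "('s::finite \<Rightarrow> 's \<Rightarrow> real) \<Rightarrow> nat \<Rightarrow> 's \<Rightarrow> 's \<Rightarrow> real" where
  "step_prob P 0 i j = (if i = j then 1 else 0)"
| "step_prob P (Suc n) i j = (\<Sum>k\<in>UNIV. P i k * step_prob P n k j)"

definition irreducible_matrix :: "('s::finite \<Rightarrow> 's \<Rightarrow> real) \<Rightarrow> bool" where
  "irreducible_matrix P \<longleftrightarrow> (\<forall>i j. \<exists>n. step_prob P n i j > 0)"

definition indexed_partition :: "'i set \<Rightarrow> ('i \<Rightarrow> 's set) \<Rightarrow> bool" where
  "indexed_partition I B \<longleftrightarrow>
     (\<forall>r\<in>I. B r \<noteq> {}) \<and> disjoint_family_on B I \<and> (\<Union>r\<in>I. B r) = UNIV"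

definition block_of :: "'i set \<Rightarrow> ('i \<Rightarrow> 's set) \<Rightarrow> 's \<Rightarrow> 'i" where
  "block_of I B i = (THE r. r \<in> I \<and> i \<in> B r)"

text \<open>The conditional probability of \<open>Z\<^sub>i = j\<close> given \<open>\<Pi> = \<pi>\<close>.\<close>

definition cond_prob ::
  "('s \<Rightarrow> 's \<Rightarrow> real) \<Rightarrow> 'i set \<Rightarrow> ('i \<Rightarrow> 's set) \<Rightarrow> ('i \<Rightarrow> 'i \<Rightarrow> real) \<Rightarrow> ('i \<Rightarrow> 'i)
     \<Rightarrow> 's \<Rightarrow> 's \<Rightarrow> real" where
  "cond_prob P I B \<Lambda> \<pi> i j =
     (let r = block_of I B i; s = block_of I B j in if \<pi> r = s then P i j / \<Lambda> r s else 0)"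

text \<open>
  Draw \<open>\<pi>\<close> from \<open>\<rho>\<close>, then all \<open>Z\<^sub>i\<close> independently given \<open>\<pi>\<close>.  The default value passed to
  \<open>Pi_pmf\<close> plays no role since its index set is \<open>UNIV\<close>.  For \<open>\<pi>\<close> in the support of \<open>\<rho>\<close> the
  argument of \<open>embed_pmf\<close> is a probability mass function; see \<open>pmf_product_measure\<close>.
\<close>

definition product_measure ::
  "('s::finite \<Rightarrow> 's \<Rightarrow> real) \<Rightarrow> 'i set \<Rightarrow> ('i \<Rightarrow> 's set) \<Rightarrow> ('i \<Rightarrow> 'i \<Rightarrow> real) \<Rightarrow> ('i \<Rightarrow> 'i) pmf
     \<Rightarrow> ('s \<Rightarrow> 's) pmf" where
  "product_measure P I B \<Lambda> \<rho> =
     do {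
       \<pi> \<leftarrow> \<rho>;
       Pi_pmf UNIV undefined (\<lambda>i. embed_pmf (cond_prob P I B \<Lambda> \<pi> i))
     }"

lemma block_of_eq:
  assumes "indexed_partition I B" "r \<in> I" "i \<in> B r"
  shows "block_of I B i = r"
  unfolding block_of_def
proof (rule the_equality)
  fix s assume "s \<in> I \<and> i \<in> B s"
  then show "s = r"
    using assms by (auto simp: indexed_partition_def disjoint_family_on_def)
qed (use assms in auto)

lemma pmf_embed_cond_prob:
  fixes P :: "'s::finite \<Rightarrow> 's \<Rightarrow> real"
  assumes st: "stochastic_on UNIV P" and part: "indexed_partition I B"
    and lump: "\<And>r s i. r \<in> I \<Longrightarrow> s \<in> I \<Longrightarrow> i \<in> B r \<Longrightarrow> (\<Sum>j\<in>B s. P i j) = \<Lambda> r s"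
    and \<rho>_perm: "set_pmf \<rho> \<subseteq> {\<pi>. \<pi> permutes I}"
    and marg: "\<And>r s. r \<in> I \<Longrightarrow> s \<in> I \<Longrightarrow> measure_pmf.prob \<rho> {\<pi>. \<pi> r = s} = \<Lambda> r s"
    and \<pi>: "\<pi> \<in> set_pmf \<rho>"
  shows "pmf (embed_pmf (cond_prob P I B \<Lambda> \<pi> i)) j = cond_prob P I B \<Lambda> \<pi> i j"
proof (rule pmf_embed_pmf)
  have *: "\<exists>r\<in>I. x \<in> B r" for x
    using part unfolding indexed_partition_def by blast
  obtain r where r: "r \<in> I" "i \<in> B r" using *[of i] by blast
  have perm: "\<pi> permutes I" using \<rho>_perm \<pi> by auto
  define s where "s = \<pi> r"
  have s: "s \<in> I" using perm r by (simp add: s_def permutes_in_image)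
  have "0 < pmf \<rho> \<pi>" using \<pi> by (simp add: pmf_positive_iff)
  also have "\<dots> = measure_pmf.prob \<rho> {\<pi>}" by (simp add: measure_pmf_single)
  also have "\<dots> \<le> measure_pmf.prob \<rho> {\<pi>. \<pi> r = s}"
    by (intro measure_pmf.finite_measure_mono) (auto simp: s_def)
  finally have pos: "\<Lambda> r s > 0" using marg[OF r(1) s] by simp
  have bj: "block_of I B j = s \<longleftrightarrow> j \<in> B s" for j
    using block_of_eq[OF part] *[of j] s by metis
  have cp: "cond_prob P I B \<Lambda> \<pi> i j = (if j \<in> B s then P i j / \<Lambda> r s else 0)" for j
    using bj[of j] by (auto simp: cond_prob_def Let_def block_of_eq[OF part r] s_def)
  show nn: "\<And>j. 0 \<le> cond_prob P I B \<Lambda> \<pi> i j"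
    using st pos by (simp add: cp stochastic_on_def)
  have "(\<Sum>j\<in>UNIV. cond_prob P I B \<Lambda> \<pi> i j) = (\<Sum>j\<in>B s. P i j / \<Lambda> r s)"
    by (simp add: cp sum.If_cases)
  also have "\<dots> = 1"
    using lump[OF r(1) s r(2)] pos by (simp flip: sum_divide_distrib)
  finally have "(\<Sum>j\<in>UNIV. cond_prob P I B \<Lambda> \<pi> i j) = 1" .
  then show "(\<integral>\<^sup>+ j. ennreal (cond_prob P I B \<Lambda> \<pi> i j) \<partial>count_space UNIV) = 1"
    by (simp add: nn_integral_count_space_finite sum_ennreal nn)
qed

lemma pmf_product_measure:
  fixes P :: "'s::finite \<Rightarrow> 's \<Rightarrow> real"
  assumes "stochastic_on UNIV P" and "indexed_partition I B"
    and "\<And>r s i. r \<in> I \<Longrightarrow> s \<in> I \<Longrightarrow> i \<in> B r \<Longrightarrow> (\<Sum>j\<in>B s. P i j) = \<Lambda> r s"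
    and "set_pmf \<rho> \<subseteq> {\<pi>. \<pi> permutes I}"
    and "\<And>r s. r \<in> I \<Longrightarrow> s \<in> I \<Longrightarrow> measure_pmf.prob \<rho> {\<pi>. \<pi> r = s} = \<Lambda> r s"
  shows "pmf (product_measure P I B \<Lambda> \<rho>) f =
           measure_pmf.expectation \<rho> (\<lambda>\<pi>. \<Prod>i\<in>UNIV. cond_prob P I B \<Lambda> \<pi> i (f i))"
  unfolding product_measure_def pmf_bind
proof (rule integral_cong_AE)
  show "AE \<pi> in measure_pmf \<rho>.
    pmf (Pi_pmf UNIV undefined (\<lambda>i. embed_pmf (cond_prob P I B \<Lambda> \<pi> i))) f =
      (\<Prod>i\<in>UNIV. cond_prob P I B \<Lambda> \<pi> i (f i))"
    by (auto simp: AE_measure_pmf_iff pmf_Pi pmf_embed_cond_prob[OF assms])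
qed auto

text \<open>
  The sample space consists of the sequences \<open>\<omega>\<close> with i.i.d. entries of law \<open>\<mu>\<close>; indices are
  shifted by one, so \<open>\<omega> t\<close> stands for \<open>F\<^sub>t\<^sub>+\<^sub>1\<close>.
\<close>

definition iid_functions :: "('s \<Rightarrow> 's) pmf \<Rightarrow> (nat \<Rightarrow> 's \<Rightarrow> 's) measure" where
  "iid_functions \<mu> = (\<Pi>\<^sub>M t\<in>UNIV. measure_pmf \<mu>)"

primrec flow :: "(nat \<Rightarrow> 's \<Rightarrow> 's) \<Rightarrow> nat \<Rightarrow> 's \<Rightarrow> 's" where
  "flow \<omega> 0 i = i"
| "flow \<omega> (Suc t) i = \<omega> t (flow \<omega> t i)"

definition coalesce :: "(nat \<Rightarrow> 's \<Rightarrow> 's) \<Rightarrow> 's \<Rightarrow> 's \<Rightarrow> bool" where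
  "coalesce \<omega> i j \<longleftrightarrow> (\<exists>t. flow \<omega> t i = flow \<omega> t j)"

definition coalescence_classes :: "(nat \<Rightarrow> 's \<Rightarrow> 's) \<Rightarrow> 's set set" where
  "coalescence_classes \<omega> = UNIV // {(i, j). coalesce \<omega> i j}"

definition coalescence_number :: "('s::finite \<Rightarrow> 's) pmf \<Rightarrow> nat" where
  "coalescence_number \<mu> =
     (THE k. AE \<omega> in iid_functions \<mu>. card (coalescence_classes \<omega>) = k)"

definition coalescence_prob :: "('s \<Rightarrow> 's) pmf \<Rightarrow> 's \<Rightarrow> 's \<Rightarrow> real" where
  "coalescence_prob \<mu> i j =
     measure (iid_functions \<mu>) {\<omega> \<in> space (iid_functions \<mu>). coalesce \<omega> i j}"

lemma coalesce_sets [measurable]: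
  fixes \<mu> :: "('s::finite \<Rightarrow> 's) pmf"
  shows "{\<omega> \<in> space (iid_functions \<mu>). coalesce \<omega> i j} \<in> sets (iid_functions \<mu>)"
proof -
  have comp: "(\<lambda>\<omega>. \<omega> t) \<in> measurable (iid_functions \<mu>) (count_space UNIV)" for t
  proof -
    have "(\<lambda>\<omega>. \<omega> t) \<in> measurable (iid_functions \<mu>) (measure_pmf \<mu>)"
      unfolding iid_functions_def by (rule measurable_component_singleton) simp
    then show ?thesis by simp
  qed
  have fl: "(\<lambda>\<omega>. flow \<omega> t x) \<in> measurable (iid_functions \<mu>) (count_space UNIV)" for t x
  proof (induction t)
    case (Suc t)
    have "(\<lambda>\<omega>. (\<lambda>f \<omega>. f (flow \<omega> t x)) (\<omega> t) \<omega>) \<in> measurable (iid_functions \<mu>) (count_space UNIV)"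
      by (rule measurable_compose_countable'[OF _ comp])
         (auto intro!: measurable_compose[OF Suc] countable_finite)
    then show ?case by simp
  qed simp
  show ?thesis
    unfolding coalesce_def using fl by measurable
qed

end

theory Submission
  imports Defs
begin

text \<open>
  A composition of functions in the support of \<open>\<mu>\<close> is given by a word over \<open>set_pmf \<mu>\<close>, and
  every such word almost surely occurs in the i.i.d. sequence.  Hence the number of coalescence
  classes is almost surely the minimal rank of such a composition.  For the product measure
  every composition permutes the blocks, so this rank is at least \<open>l\<close>.  A composition of rank \<open>l\<close>
  identifies all points of a block, which gives one implication.  Conversely, if two points in
  the image of a composition of minimal rank shared a block, irreducibility would allow us to move
  this block to the first one and then to merge the two points there, lowering the rank further.
\<close>

section \<open>Words in an i.i.d. sequence\<close>

definition occurs_at :: "'a list \<Rightarrow> nat \<Rightarrow> (nat \<Rightarrow> 'a) \<Rightarrow> bool" where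
  "occurs_at w n \<omega> \<longleftrightarrow> (\<forall>k<length w. \<omega> (n + k) = w ! k)"

lemma sequence_space_pmf: "sequence_space (measure_pmf \<mu>)"
  by (intro sequence_space.intro product_prob_space.intro product_prob_space_axioms.intro
      product_sigma_finite.intro measure_pmf.sigma_finite_measure_axioms
      measure_pmf.prob_space_axioms)

lemma prob_space_iid: "prob_space (iid_functions \<mu>)"
  unfolding iid_functions_def by (intro prob_space_PiM measure_pmf.prob_space_axioms)

lemma space_iid [simp]: "space (iid_functions \<mu>) = UNIV"
  by (simp add: iid_functions_def space_PiM)

lemma measurable_occurs_at [measurable]:
  "Measurable.pred (\<Pi>\<^sub>M t\<in>(UNIV :: nat set). measure_pmf \<mu>) (occurs_at w n)"
proof -
  have "(\<lambda>\<omega>. \<omega> t) \<in> measurable (\<Pi>\<^sub>M t\<in>(UNIV :: nat set). measure_pmf \<mu>) (count_space UNIV)" for t :: nat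
    by (rule measurable_compose[OF measurable_component_singleton]) auto
  note [measurable] = this
  show ?thesis
    unfolding occurs_at_def by measurable
qed

lemma AE_iid_in_support: "AE \<omega> in iid_functions \<mu>. \<forall>t. \<omega> t \<in> set_pmf \<mu>"
  unfolding iid_functions_def
  by (intro AE_all_countable[THEN iffD2] allI AE_PiM_component)
     (auto simp: AE_measure_pmf_iff intro: measure_pmf.prob_space_axioms)

text \<open>By independence this probability is the product of the masses of the letters, each of
  which is positive.\<close>

lemma occurs_at_0_pos:
  assumes "set w \<subseteq> set_pmf \<mu>"
  shows "measure (iid_functions \<mu>) {\<omega>. occurs_at w 0 \<omega>} > 0"
proof -
  interpret sequence_space "measure_pmf \<mu>" by (rule sequence_space_pmf)
  have "{\<omega>. occurs_at w 0 \<omega>} = {\<omega> \<in> space S. \<forall>k\<in>{..<length w}. \<omega> k \<in> {w ! k}}"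
    by (simp add: occurs_at_def space_PiM Ball_def)
  then have "emeasure S {\<omega>. occurs_at w 0 \<omega>} = (\<Prod>k<length w. emeasure \<mu> {w ! k})"
    using emeasure_PiM_Collect[of "{..<length w}" "\<lambda>k. {w ! k}"] by simp
  then have "measure (iid_functions \<mu>) {\<omega>. occurs_at w 0 \<omega>} = (\<Prod>k<length w. pmf \<mu> (w ! k))"
    by (simp add: iid_functions_def measure_def emeasure_pmf_single prod_ennreal prod_nonneg)
  also have "\<dots> > 0"
    using assms by (intro prod_pos) (auto simp: pmf_positive_iff)
  finally show ?thesis .
qed

text \<open>
  If \<open>w\<close> never occurs, then it is not a prefix and it never occurs in the shifted sequence.  By
  independence the probability \<open>a\<close> of this event satisfies \<open>a \<le> (1 - p) * a\<close>, where \<open>p > 0\<close>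
  is the probability that \<open>w\<close> is a prefix.
\<close>

lemma AE_occurs:
  assumes "set w \<subseteq> set_pmf \<mu>"
  shows "AE \<omega> in iid_functions \<mu>. \<exists>n. occurs_at w n \<omega>"
proof -
  interpret sequence_space "measure_pmf \<mu>" by (rule sequence_space_pmf)
  let ?m = "length w"
  define A where "A = {\<omega> \<in> space S. \<not> (\<exists>n. occurs_at w n \<omega>)}"
  define C where "C = {\<omega> \<in> space S. \<not> occurs_at w 0 \<omega>}"
  have A[measurable]: "A \<in> sets S" unfolding A_def by measurable
  have C[measurable]: "C \<in> sets S" unfolding C_def by measurable
  define p where "p = measure S {\<omega> \<in> space S. occurs_at w 0 \<omega>}"
  have p: "p > 0"
    using occurs_at_0_pos[OF assms] by (simp add: p_def iid_functions_def space_PiM)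
  have C_eq: "measure S C = 1 - p"
    unfolding p_def C_def by (rule P.prob_neg) measurable
  \<comment> \<open>\<open>comb_seq ?m\<close> glues the first \<open>?m\<close> entries of
    \<open>\<omega>\<close> to \<open>\<omega>'\<close>. Cutting at the length of \<open>w\<close>
    makes the prefix a matter of \<open>\<omega>\<close> alone, while an occurrence of
    \<open>w\<close> in \<open>\<omega>'\<close> is merely shifted by \<open>?m\<close>.\<close>
  have sub: "(\<lambda>(\<omega>, \<omega>'). comb_seq ?m \<omega> \<omega>') -` A \<inter> space (S \<Otimes>\<^sub>M S) \<subseteq> C \<times> A"
  proof clarify
    fix \<omega> \<omega>' assume *: "comb_seq ?m \<omega> \<omega>' \<in> A"
    have "occurs_at w 0 \<omega> \<Longrightarrow> occurs_at w 0 (comb_seq ?m \<omega> \<omega>')"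
      by (simp add: occurs_at_def comb_seq_less)
    moreover have "occurs_at w n \<omega>' \<Longrightarrow> occurs_at w (?m + n) (comb_seq ?m \<omega> \<omega>')" for n
      by (simp add: occurs_at_def comb_seq_def)
    ultimately show "\<omega> \<in> C \<and> \<omega>' \<in> A"
      using * by (auto simp: A_def C_def space_PiM)
  qed
  have "emeasure S A = emeasure (distr (S \<Otimes>\<^sub>M S) S (\<lambda>(\<omega>, \<omega>'). comb_seq ?m \<omega> \<omega>')) A"
    by (simp only: PiM_comb_seq)
  also have "\<dots> = emeasure (S \<Otimes>\<^sub>M S) ((\<lambda>(\<omega>, \<omega>'). comb_seq ?m \<omega> \<omega>') -` A \<inter> space (S \<Otimes>\<^sub>M S))"
    by (rule emeasure_distr[OF measurable_comb_seq A])
  also have "\<dots> \<le> emeasure (S \<Otimes>\<^sub>M S) (C \<times> A)"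
    by (rule emeasure_mono[OF sub]) measurable
  also have "\<dots> = emeasure S C * emeasure S A"
    by (rule P.emeasure_pair_measure_Times) measurable
  finally have "measure S A \<le> measure S C * measure S A"
    by (simp add: P.emeasure_eq_measure ennreal_mult' [symmetric])
  then have "p * measure S A \<le> 0"
    by (simp add: C_eq algebra_simps)
  with p have "measure S A = 0"
    by (metis measure_nonneg mult_le_0_iff not_less order_antisym)
  then have "AE \<omega> in S. \<omega> \<notin> A"
    by (simp add: P.prob_eq_0 [symmetric])
  then show ?thesis
    unfolding iid_functions_def by eventually_elim (simp add: A_def space_PiM)
qed

section \<open>The coalescence number as a minimal rank\<close>

text \<open>The first letter of a word acts first, as in \<open>flow\<close>.\<close>

abbreviation act :: "('a \<Rightarrow> 'a) list \<Rightarrow> 'a \<Rightarrow> 'a" where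
  "act \<equiv> fold (\<lambda>f. f)"

lemma flow_occurs_at:
  assumes "occurs_at w n \<omega>"
  shows "flow \<omega> (n + length w) i = act w (flow \<omega> n i)"
  using assms
proof (induction w rule: rev_induct)
  case (snoc f w)
  then have "occurs_at w n \<omega>" and "\<omega> (n + length w) = f"
    by (auto simp: occurs_at_def nth_append dest: spec[of _ "length w"])
  then show ?case using snoc.IH by simp
qed simp

lemma flow_eq_act: "flow \<omega> t = act (map \<omega> [0..<t])"
  by (induction t) (auto simp: fun_eq_iff)

lemma flow_eq_mono:
  assumes "flow \<omega> t i = flow \<omega> t j" "t \<le> u"
  shows "flow \<omega> u i = flow \<omega> u j"
  using assms(2,1) by (induction rule: dec_induct) auto

text \<open>Flows that have met stay together, and there are only finitely many pairs, so one time
  serves them all.\<close>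

lemma coalesce_eventually:
  fixes \<omega> :: "nat \<Rightarrow> 's::finite \<Rightarrow> 's"
  obtains T where "\<And>t i j. t \<ge> T \<Longrightarrow> coalesce \<omega> i j \<longleftrightarrow> flow \<omega> t i = flow \<omega> t j"
proof -
  \<comment> \<open>For a pair that never coalesces this is an arbitrary time, which is harmless:
    its flows differ at every time.\<close>
  define \<tau> where "\<tau> i j = (SOME t. flow \<omega> t i = flow \<omega> t j)" for i j
  have \<tau>: "flow \<omega> (\<tau> i j) i = flow \<omega> (\<tau> i j) j" if "coalesce \<omega> i j" for i j
    using that unfolding coalesce_def \<tau>_def by (rule someI_ex)
  define T where "T = Max (range (case_prod \<tau>))"
  have "\<tau> i j \<le> T" for i j
    unfolding T_def by (intro Max_ge) (auto intro: image_eqI[of _ _ "(i, j)"])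
  then have "coalesce \<omega> i j \<longleftrightarrow> flow \<omega> t i = flow \<omega> t j" if "t \<ge> T" for t i j
    using \<tau> flow_eq_mono that unfolding coalesce_def by (metis order_trans)
  then show ?thesis using that by blast
qed

lemma card_quotient_kernel:
  fixes f :: "'a::finite \<Rightarrow> 'b"
  shows "card (UNIV // {(i, j). f i = f j}) = card (range f)"
proof -
  have "UNIV // {(i, j). f i = f j} = (\<lambda>y. f -` {y}) ` range f"
    by (auto simp: quotient_def image_iff vimage_def Image_def eq_commute)
  moreover have "inj_on (\<lambda>y. f -` {y}) (range f)"
    by (auto simp: inj_on_def)
  ultimately show ?thesis by (simp add: card_image)
qed

lemma card_coalescence_classes:
  fixes \<omega> :: "nat \<Rightarrow> 's::finite \<Rightarrow> 's"
  obtains T where "\<And>t. t \<ge> T \<Longrightarrow> card (coalescence_classes \<omega>) = card (range (flow \<omega> t))"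
proof -
  obtain T where T: "\<And>t i j. t \<ge> T \<Longrightarrow> coalesce \<omega> i j \<longleftrightarrow> flow \<omega> t i = flow \<omega> t j"
    using coalesce_eventually by blast
  have "card (coalescence_classes \<omega>) = card (range (flow \<omega> t))" if "t \<ge> T" for t
    by (simp add: coalescence_classes_def T[OF that] card_quotient_kernel)
  then show ?thesis by (rule that)
qed

text \<open>The least rank in the monoid generated by the support; the empty word contributes the
  identity.\<close>

definition min_rank :: "('s::finite \<Rightarrow> 's) pmf \<Rightarrow> nat" where
  "min_rank \<mu> = (LEAST m. \<exists>w. set w \<subseteq> set_pmf \<mu> \<and> card (range (act w)) = m)"

lemma min_rank_le:
  assumes "set w \<subseteq> set_pmf \<mu>"
  shows "min_rank \<mu> \<le> card (range (act w))"
  unfolding min_rank_def using assms by (intro Least_le) blast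

lemma min_rank_attained:
  obtains w where "set w \<subseteq> set_pmf \<mu>" "card (range (act w)) = min_rank \<mu>"
proof -
  have "\<exists>m w. set w \<subseteq> set_pmf \<mu> \<and> card (range (act w)) = m"
    by (intro exI[of _ "[]"] exI) auto
  from LeastI_ex[OF this] show ?thesis
    using that unfolding min_rank_def by blast
qed

text \<open>Once a word of minimal rank has occurred, the flow factors through it, which bounds its
  rank from above. The bound from below holds because the flow is itself a composition of functions
  in the support.\<close>

lemma AE_card_coalescence_classes:
  fixes \<mu> :: "('s::finite \<Rightarrow> 's) pmf"
  shows "AE \<omega> in iid_functions \<mu>. card (coalescence_classes \<omega>) = min_rank \<mu>"
proof -
  obtain w where w: "set w \<subseteq> set_pmf \<mu>" "card (range (act w)) = min_rank \<mu>"
    by (rule min_rank_attained)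
  show ?thesis
    using AE_occurs[OF w(1)] AE_iid_in_support[of \<mu>]
  proof eventually_elim
    case (elim \<omega>)
    obtain T where T: "\<And>t. t \<ge> T \<Longrightarrow> card (coalescence_classes \<omega>) = card (range (flow \<omega> t))"
        using card_coalescence_classes by blast
    obtain n where n: "occurs_at w n \<omega>" using elim by blast
    define u where "u = n + length w"
    have "flow \<omega> (u + k) i \<in> act (map \<omega> [u..<u+k]) ` range (act w)" for k i
    proof (induction k)
      case 0
      then show ?case using flow_occurs_at[OF n] by (simp add: u_def)
    next
      case (Suc k)
      then show ?case by auto
    qed
    \<comment> \<open>Time \<open>u + T\<close> lies both after the occurrence of \<open>w\<close>
      and after the coalescence relation has stabilised.\<close>
    then have "range (flow \<omega> (u + T)) \<subseteq> act (map \<omega> [u..<u+T]) ` range (act w)"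
      by blast
    then have "card (range (flow \<omega> (u + T))) \<le> card (range (act w))"
      by (meson card_image_le card_mono finite le_trans)
    moreover have "min_rank \<mu> \<le> card (range (flow \<omega> (u + T)))"
      unfolding flow_eq_act using elim by (intro min_rank_le) auto
    ultimately show ?case using T[of "u + T"] w(2) by simp
  qed
qed

lemma coalescence_number_eq_min_rank:
  fixes \<mu> :: "('s::finite \<Rightarrow> 's) pmf"
  shows "coalescence_number \<mu> = min_rank \<mu>"
  unfolding coalescence_number_def
proof (rule the_equality)
  interpret prob_space "iid_functions \<mu>" by (rule prob_space_iid)
  fix k assume "AE \<omega> in iid_functions \<mu>. card (coalescence_classes \<omega>) = k"
  with AE_card_coalescence_classes[of \<mu>] have "AE \<omega> in iid_functions \<mu>. k = min_rank \<mu>"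
    by eventually_elim simp
  \<comment> \<open>In a probability space, a statement that does not depend on
    \<open>\<omega>\<close> and holds almost surely is true.\<close>
  then show "k = min_rank \<mu>" by simp
qed (rule AE_card_coalescence_classes)

text \<open>Reduces the probabilistic condition to words: a coalescing sample path in the support
  has a merging word as prefix, and conversely a merging word is a prefix with positive
  probability.\<close>

lemma coalescence_prob_pos_iff:
  fixes \<mu> :: "('s::finite \<Rightarrow> 's) pmf"
  shows "coalescence_prob \<mu> i j > 0 \<longleftrightarrow> (\<exists>w. set w \<subseteq> set_pmf \<mu> \<and> act w i = act w j)"
proof
  interpret prob_space "iid_functions \<mu>" by (rule prob_space_iid)
  assume pos: "coalescence_prob \<mu> i j > 0"
  have "\<not> (AE \<omega> in iid_functions \<mu>. \<not> coalesce \<omega> i j)"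
  proof
    assume "AE \<omega> in iid_functions \<mu>. \<not> coalesce \<omega> i j"
    then have "coalescence_prob \<mu> i j = 0"
      unfolding coalescence_prob_def using prob_eq_0[OF coalesce_sets[of \<mu> i j]] by simp
    with pos show False by simp
  qed
  with AE_iid_in_support[of \<mu>] obtain \<omega> where "\<forall>t. \<omega> t \<in> set_pmf \<mu>" "coalesce \<omega> i j"
    by (metis (mono_tags, lifting) AE_mp AE_I2)
  then show "\<exists>w. set w \<subseteq> set_pmf \<mu> \<and> act w i = act w j"
    unfolding coalesce_def flow_eq_act by (metis (no_types, lifting) image_subsetI set_map)
next
  interpret prob_space "iid_functions \<mu>" by (rule prob_space_iid)
  assume "\<exists>w. set w \<subseteq> set_pmf \<mu> \<and> act w i = act w j"
  then obtain w where w: "set w \<subseteq> set_pmf \<mu>" "act w i = act w j" by blast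
  have "0 < measure (iid_functions \<mu>) {\<omega>. occurs_at w 0 \<omega>}"
    by (rule occurs_at_0_pos[OF w(1)])
  also have "\<dots> \<le> coalescence_prob \<mu> i j"
    unfolding coalescence_prob_def
  proof (rule finite_measure_mono[OF _ coalesce_sets])
    show "{\<omega>. occurs_at w 0 \<omega>} \<subseteq> {\<omega> \<in> space (iid_functions \<mu>). coalesce \<omega> i j}"
      using flow_occurs_at[of w 0] w(2) by (auto simp: coalesce_def intro!: exI[of _ "length w"])
  qed
  finally show "coalescence_prob \<mu> i j > 0" .
qed

section \<open>The support of the product measure\<close>

lemma indexed_partition_block_of:
  assumes "indexed_partition I B"
  shows "block_of I B i \<in> I" "i \<in> B (block_of I B i)"
proof -
  obtain r where "r \<in> I" "i \<in> B r"
    using assms unfolding indexed_partition_def by blast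
  then show "block_of I B i \<in> I" "i \<in> B (block_of I B i)"
    using block_of_eq[OF assms] by auto
qed

locale product_measure_setup =
  fixes P :: "'s::finite \<Rightarrow> 's \<Rightarrow> real" and I :: "'i set" and B :: "'i \<Rightarrow> 's set"
    and \<Lambda> :: "'i \<Rightarrow> 'i \<Rightarrow> real" and \<rho> :: "('i \<Rightarrow> 'i) pmf"
  assumes st: "stochastic_on UNIV P"
    and part: "indexed_partition I B"
    and lump: "\<And>r s i. r \<in> I \<Longrightarrow> s \<in> I \<Longrightarrow> i \<in> B r \<Longrightarrow> (\<Sum>j\<in>B s. P i j) = \<Lambda> r s"
    and perm: "set_pmf \<rho> \<subseteq> {\<pi>. \<pi> permutes I}"
    and marg: "\<And>r s. r \<in> I \<Longrightarrow> s \<in> I \<Longrightarrow> measure_pmf.prob \<rho> {\<pi>. \<pi> r = s} = \<Lambda> r s"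
begin

abbreviation "\<mu> \<equiv> product_measure P I B \<Lambda> \<rho>"
abbreviation "block \<equiv> block_of I B"

lemma set_embed_cond_prob:
  assumes "\<pi> \<in> set_pmf \<rho>"
  shows "set_pmf (embed_pmf (cond_prob P I B \<Lambda> \<pi> i)) = {j. cond_prob P I B \<Lambda> \<pi> i j \<noteq> 0}"
  using pmf_embed_cond_prob[OF st part lump perm marg assms] by (auto simp: set_pmf_eq)

lemma in_set_product_measure:
  "f \<in> set_pmf \<mu> \<longleftrightarrow> (\<exists>\<pi>\<in>set_pmf \<rho>. \<forall>i. cond_prob P I B \<Lambda> \<pi> i (f i) \<noteq> 0)"
  unfolding product_measure_def
  by (auto simp: set_Pi_pmf PiE_dflt_def set_embed_cond_prob)

text \<open>One permutation serves all points, and \<open>cond_prob\<close> vanishes unless the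
  target lies in the block that it prescribes.\<close>

lemma block_support:
  assumes "f \<in> set_pmf \<mu>"
  obtains \<pi> where "\<pi> permutes I" "\<And>i. block (f i) = \<pi> (block i)"
proof -
  obtain \<pi> where "\<pi> \<in> set_pmf \<rho>" "\<And>i. cond_prob P I B \<Lambda> \<pi> i (f i) \<noteq> 0"
    using assms unfolding in_set_product_measure by blast
  then show ?thesis
    using that[of \<pi>] perm unfolding cond_prob_def Let_def by (metis mem_Collect_eq subsetD)
qed

lemma block_word:
  assumes "set w \<subseteq> set_pmf \<mu>"
  obtains \<pi> where "\<pi> permutes I" "\<And>i. block (act w i) = \<pi> (block i)"
proof -
  have "\<exists>\<pi>. \<pi> permutes I \<and> (\<forall>i. block (act w i) = \<pi> (block i))"
    using assms
  proof (induction w rule: rev_induct)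
    case Nil
    show ?case by (rule exI[of _ id]) (use permutes_id[of I] in \<open>simp add: id_def\<close>)
  next
    case (snoc f w)
    then obtain \<pi> where \<pi>: "\<pi> permutes I" "\<And>i. block (act w i) = \<pi> (block i)"
      by auto
    from snoc.prems obtain \<sigma> where \<sigma>: "\<sigma> permutes I" "\<And>i. block (f i) = \<sigma> (block i)"
      using block_support[of f] by auto
    show ?case
    proof (intro exI conjI)
      show "\<sigma> \<circ> \<pi> permutes I" by (rule permutes_compose[OF \<pi>(1) \<sigma>(1)])
    qed (simp add: \<pi>(2) \<sigma>(2))
  qed
  then show ?thesis using that by blast
qed

text \<open>Blocks are non-empty and get permuted, so none can be missed. This is the source of the
  lower bound \<open>card I\<close> for all ranks.\<close>

lemma block_image_word:
  assumes "set w \<subseteq> set_pmf \<mu>"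
  shows "block ` range (act w) = I"
proof -
  obtain \<pi> where \<pi>: "\<pi> permutes I" "\<And>i. block (act w i) = \<pi> (block i)"
    using block_word[OF assms] by blast
  have "range block = I"
  proof
    show "range block \<subseteq> I"
      using indexed_partition_block_of(1)[OF part] by blast
    show "I \<subseteq> range block"
    proof
      fix r assume r: "r \<in> I"
      then obtain i where "i \<in> B r"
        using part unfolding indexed_partition_def by blast
      then show "r \<in> range block"
        using block_of_eq[OF part r] by blast
    qed
  qed
  moreover have "block ` range (act w) = \<pi> ` range block"
    by (simp add: image_image \<pi>(2))
  ultimately show ?thesis
    by (simp only: permutes_image[OF \<pi>(1)])
qed

text \<open>A positive entry of \<open>P\<close> makes the entry of \<open>\<Lambda>\<close> for the
  two blocks positive, so some permutation in the support of \<open>\<rho>\<close> sends the first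
  block to the second.\<close>

lemma support_realises_transition:
  assumes "P i j > 0"
  shows "\<exists>f\<in>set_pmf \<mu>. f i = j"
proof -
  let ?r = "block i" and ?s = "block j"
  note b = indexed_partition_block_of[OF part]
  have "P i j \<le> (\<Sum>k\<in>B ?s. P i k)"
    using b st by (intro member_le_sum) (auto simp: stochastic_on_def)
  also have "\<dots> = \<Lambda> ?r ?s"
    using b by (intro lump)
  finally have \<Lambda>: "\<Lambda> ?r ?s > 0" using assms by simp
  then have "measure_pmf.prob \<rho> {\<pi>. \<pi> ?r = ?s} \<noteq> 0"
    using marg[OF b(1) b(1), of i j] by simp
  then obtain \<pi> where \<pi>: "\<pi> \<in> set_pmf \<rho>" "\<pi> ?r = ?s"
    by (auto simp: measure_pmf_zero_iff)
  have "\<exists>k. cond_prob P I B \<Lambda> \<pi> i' k \<noteq> 0" for i'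
    using set_pmf_not_empty[of "embed_pmf (cond_prob P I B \<Lambda> \<pi> i')"] set_embed_cond_prob[OF \<pi>(1)]
    by auto
  then obtain g where g: "\<And>i'. cond_prob P I B \<Lambda> \<pi> i' (g i') \<noteq> 0" by metis
  moreover have "cond_prob P I B \<Lambda> \<pi> i j \<noteq> 0"
    using assms \<Lambda> \<pi>(2) by (simp add: cond_prob_def Let_def)
  \<comment> \<open>Given \<open>\<pi>\<close> the values at distinct points are independent, so
    \<open>g\<close> may be altered at \<open>i\<close> alone.\<close>
  ultimately have "g(i := j) \<in> set_pmf \<mu>"
    unfolding in_set_product_measure using \<pi>(1) by auto
  then show ?thesis by (intro bexI[of _ "g(i := j)"]) auto
qed

text \<open>A path of positive probability is followed letter by letter: each letter only has to
  send the current state to the next one.\<close>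

lemma word_realises_step:
  assumes "step_prob P n i j > 0"
  shows "\<exists>w. set w \<subseteq> set_pmf \<mu> \<and> act w i = j"
  using assms
proof (induction n arbitrary: i)
  case 0
  then show ?case by (intro exI[of _ "[]"]) (auto split: if_splits)
next
  case (Suc n)
  have nonneg: "P i k \<ge> 0" for k
    using st by (simp add: stochastic_on_def)
  obtain k where "P i k * step_prob P n k j > 0"
  proof (rule ccontr)
    assume "\<not> thesis"
    with that have "P i k * step_prob P n k j \<le> 0" for k
      by (meson not_less)
    then have "step_prob P (Suc n) i j \<le> 0"
      by (simp add: sum_nonpos)
    with Suc.prems show False by simp
  qed
  with nonneg[of k] have "P i k > 0" "step_prob P n k j > 0"
    by (simp_all add: zero_less_mult_iff)
  then obtain f w where "f \<in> set_pmf \<mu>" "f i = k" "set w \<subseteq> set_pmf \<mu>" "act w k = j"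
    using support_realises_transition Suc.IH by blast
  then show ?case by (intro exI[of _ "f # w"]) auto
qed

section \<open>The minimal rank compared with the number of blocks\<close>

lemma card_index_le_min_rank: "card I \<le> min_rank \<mu>"
proof -
  obtain w where w: "set w \<subseteq> set_pmf \<mu>" "card (range (act w)) = min_rank \<mu>"
    by (rule min_rank_attained)
  have "card (block ` range (act w)) \<le> card (range (act w))"
    by (rule card_image_le) simp
  then show ?thesis
    unfolding block_image_word[OF w(1)] w(2) .
qed

text \<open>For a word of rank \<open>card I\<close>, the surjection \<open>block\<close> from its
  image to \<open>I\<close> is injective by counting. Points of one block are sent into one block,
  hence to the same point.\<close>

lemma coalescence_prob_pos_of_min_rank:
  assumes "min_rank \<mu> = card I" "block i = block j"
  shows "coalescence_prob \<mu> i j > 0"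
proof -
  obtain w where w: "set w \<subseteq> set_pmf \<mu>" "card (range (act w)) = min_rank \<mu>"
    by (rule min_rank_attained)
  have "inj_on block (range (act w))"
    by (rule eq_card_imp_inj_on) (simp_all only: finite block_image_word[OF w(1)] w(2) assms(1))
  moreover have "block (act w i) = block (act w j)"
    using block_word[OF w(1)] assms(2) by metis
  ultimately have "act w i = act w j"
    by (meson inj_onD rangeI)
  then show ?thesis
    using w(1) coalescence_prob_pos_iff by blast
qed

text \<open>Merging inside the single block \<open>B r\<close> is enough, since irreducibility lets
  any point be moved into it.\<close>

lemma min_rank_le_of_coalescence_prob_pos:
  assumes irr: "irreducible_matrix P" and r: "r \<in> I"
    and pos: "\<And>i j. i \<in> B r \<Longrightarrow> j \<in> B r \<Longrightarrow> coalescence_prob \<mu> i j > 0"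
  shows "min_rank \<mu> \<le> card I"
proof -
  obtain w where w: "set w \<subseteq> set_pmf \<mu>" "card (range (act w)) = min_rank \<mu>"
    by (rule min_rank_attained)
  have "inj_on block (range (act w))"
  proof (rule inj_onI, rule ccontr)
    fix x y
    assume xy: "x \<in> range (act w)" "y \<in> range (act w)" "block x = block y" "x \<noteq> y"
    obtain z where z: "z \<in> B r"
      using part r unfolding indexed_partition_def by blast
    obtain n where "step_prob P n x z > 0"
      using irr unfolding irreducible_matrix_def by blast
    then obtain u where u: "set u \<subseteq> set_pmf \<mu>" "act u x = z"
      using word_realises_step by blast
    \<comment> \<open>The word \<open>u\<close> was chosen for \<open>x\<close> only, but it
      permutes whole blocks and so carries \<open>y\<close> into \<open>B r\<close> as well.\<close>
    have "block (act u y) = block (act u x)"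
      using block_word[OF u(1)] xy(3) by metis
    then have "act u y \<in> B r"
      using u(2) block_of_eq[OF part r z] indexed_partition_block_of(2)[OF part] by metis
    then obtain v where v: "set v \<subseteq> set_pmf \<mu>" "act v (act u x) = act v (act u y)"
      using pos[of z "act u y"] z u(2) coalescence_prob_pos_iff by blast
    define g where "g = act (u @ v)"
    have "g x = g y" using v by (simp add: g_def)
    \<comment> \<open>Appending \<open>u @ v\<close> to \<open>w\<close> merges two distinct points
      of the image, so the rank drops below the minimum.\<close>
    with xy have "\<not> inj_on g (range (act w))" by (auto dest: inj_onD)
    then have "card (g ` range (act w)) < card (range (act w))"
      by (meson card_image_le eq_card_imp_inj_on finite le_neq_implies_less)
    moreover have "g ` range (act w) = range (act (w @ u @ v))"
      by (auto simp: g_def)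
    moreover have "min_rank \<mu> \<le> card (range (act (w @ u @ v)))"
      using w u v by (intro min_rank_le) auto
    ultimately show False using w(2) by simp
  qed
  from card_image[OF this] have "card I = min_rank \<mu>"
    unfolding block_image_word[OF w(1)] w(2) .
  then show ?thesis
    by (rule eq_refl[OF sym])
qed

lemma coalescence_number_eq_card_iff:
  assumes "irreducible_matrix P" "r \<in> I"
  shows "coalescence_number \<mu> = card I \<longleftrightarrow>
           (\<forall>i\<in>B r. \<forall>j\<in>B r. coalescence_prob \<mu> i j > 0)"
  unfolding coalescence_number_eq_min_rank
proof (intro iffI ballI)
  fix i j assume "min_rank \<mu> = card I" "i \<in> B r" "j \<in> B r"
  then show "coalescence_prob \<mu> i j > 0"
    by (intro coalescence_prob_pos_of_min_rank) (simp_all only: block_of_eq[OF part assms(2)])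
next
  assume "\<forall>i\<in>B r. \<forall>j\<in>B r. coalescence_prob \<mu> i j > 0"
  then have "min_rank \<mu> \<le> card I"
    by (intro min_rank_le_of_coalescence_prob_pos[OF assms]) blast
  with card_index_le_min_rank show "min_rank \<mu> = card I"
    by (rule antisym[rotated])
qed

end

theorem theorem5p3:
  fixes P :: "'s::finite \<Rightarrow> 's \<Rightarrow> real"
    and l :: nat
    and B :: "nat \<Rightarrow> 's set"
    and \<Lambda> :: "nat \<Rightarrow> nat \<Rightarrow> real"
    and \<rho> :: "(nat \<Rightarrow> nat) pmf"
  defines "I \<equiv> {1..l}"
  defines "\<mu> \<equiv> product_measure P I B \<Lambda> \<rho>"
  assumes "stochastic_on UNIV P"
    and "irreducible_matrix P"
    and "indexed_partition I B"
    and "\<And>r s i. r \<in> I \<Longrightarrow> s \<in> I \<Longrightarrow> i \<in> B r \<Longrightarrow> (\<Sum>j\<in>B s. P i j) = \<Lambda> r s"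
    and "doubly_stochastic_on I \<Lambda>"
    and "set_pmf \<rho> \<subseteq> {\<pi>. \<pi> permutes I}"
    and "\<And>r s. r \<in> I \<Longrightarrow> s \<in> I \<Longrightarrow> measure_pmf.prob \<rho> {\<pi>. \<pi> r = s} = \<Lambda> r s"
  shows "coalescence_number \<mu> = l \<longleftrightarrow>
           (\<forall>i\<in>B 1. \<forall>j\<in>B 1. coalescence_prob \<mu> i j > 0)"
proof -
  interpret product_measure_setup P I B \<Lambda> \<rho>
    by (rule product_measure_setup.intro[OF assms(3,5,6,8,9)])
  \<comment> \<open>This amounts to \<open>l \<ge> 1\<close>: the state space is non-empty, and the
    block index of an arbitrary state lies in \<open>I\<close>.\<close>
  have "1 \<in> I"
    using indexed_partition_block_of(1)[OF part, of undefined] by (simp add: I_def)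
  from coalescence_number_eq_card_iff[OF \<open>irreducible_matrix P\<close> this] show ?thesis
    by (simp add: I_def \<mu>_def)
qed

end
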